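(* Let $C\subset\mathbb P^2$ be a plane curve of degree $d$ through $O$, smooth at $O$, and let $D\subset\mathbb P^2$ be a line. Then $\Delta_{C,s_+}=\Delta_{d,\frac sd,\frac1d}$ for every rational $s\ge d^2$. In particular, for such $s$, $$\Delta_{(C,O)}(D)=\Delta_{\frac1d,d}=\begin{pmatrix}0&1\\1&-s\end{pmatrix}\Delta_{C,s_+},$$ where the matrix acts on column vectors $(t,u)^T$.
   Context: Work over $\mathbb C$; $x=X/Z$, $y=Y/Z$, $O=(0,0)$; $C$ tangent to $\{y=0\}$ at $O$, locally $x\mapsto(x,\xi(x))$, $\xi\in\mathbb C[[x]]$, $\xi(0)=\xi'(0)=0$. For $f\ne0$ with $C$-expansion $f=\sum a_{ij}x^i(y-\xi(x))^j$, $v_1(C,s;f)=\min\{i+sj:a_{ij}\ne0\}$ and, for rational $s$, $v_+(C,s)(f)=(v_1(C,s;f),\min\{j:\exists i,\ a_{ij}\ne0,\ i+sj=v_1(C,s;f)\})$. $\Delta_{C,s_+}\subset\mathbb R^2$ (coordinates $(t,u)$) is the closure of the convex hull of $\{v_+(C,s)(F/Z^k)/k:k\ge1,\ F\ne0\text{ homogeneous of degree }k\}$. $\Delta_{(C,O)}(D)$ is the Newton–Okounkov body of the line class with respect to the flag $\mathbb P^2\supset C\supset O$, i.e. built in the same way from the flag valuation $\nu(\phi)=(\operatorname{ord}_C\phi,\operatorname{ord}_O((\phi/g^{\operatorname{ord}_C\phi})|_C))$, $g$ a local equation of $C$ at $O$. $\Delta_{a,b,c}$ is the triangle with vertices $(0,0),(a,0),(b,c)$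 and $\Delta_{a,c}=\Delta_{a,0,c}$.
   Formalization: The plane curve C is assumed irreducible; for reducible C the claim fails, since Δ_{C,s+} depends only on the component through O (e.g. the pair of lines Y(Y−Z)=0 with d=2 gives the triangle for d=1). *)

theory Defs
  imports "HOL-Analysis.Analysis" "HOL-Computational_Algebra.Computational_Algebra"
begin

text \<open>Homogeneous polynomials in X, Y, Z over the complex numbers are represented as
  nested univariate polynomials: the outermost variable is X, then Y, innermost Z.
  hcoeff F a b c is the coefficient of X^a Y^b Z^c.\<close>

definition hcoeff :: "complex poly poly poly \<Rightarrow> nat \<Rightarrow> nat \<Rightarrow> nat \<Rightarrow> complex" where
  "hcoeff F a b c = coeff (coeff (coeff F a) b) c"

definition homogeneous_deg :: "complex poly poly poly \<Rightarrow> nat \<Rightarrow> bool" where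
  "homogeneous_deg F k \<longleftrightarrow> (\<forall>a b c. hcoeff F a b c \<noteq> 0 \<longrightarrow> a + b + c = k)"

text \<open>The dehomogenisation f = F(x,y,1), written in the local coordinates (x, w) with
  w = y - xi(x), as an element of C[[x,w]] = complex fps fps
  (outer variable w, inner variable x).  Its coefficient of x^i w^j is a_ij, the
  C-expansion coefficient.\<close>

definition cexp :: "complex fps \<Rightarrow> complex poly poly poly \<Rightarrow> complex fps fps" where
  "cexp \<xi> F = (\<Sum>a\<le>degree F. \<Sum>b\<le>degree (coeff F a).
      fps_const (fps_const (poly (coeff (coeff F a) b) 1) * fps_X ^ a)
        * (fps_X + fps_const \<xi>) ^ b)"

definition acoef :: "complex fps \<Rightarrow> complex poly poly poly \<Rightarrow> nat \<Rightarrow> nat \<Rightarrow> complex" where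
  "acoef \<xi> F i j = fps_nth (fps_nth (cexp \<xi> F) j) i"

definition v1 :: "complex fps \<Rightarrow> real \<Rightarrow> complex poly poly poly \<Rightarrow> real" where
  "v1 \<xi> s F = Inf {real i + s * real j | i j. acoef \<xi> F i j \<noteq> 0}"

definition vplus :: "complex fps \<Rightarrow> real \<Rightarrow> complex poly poly poly \<Rightarrow> real \<times> real" where
  "vplus \<xi> s F = (v1 \<xi> s F,
     Inf {real j | j. \<exists>i. acoef \<xi> F i j \<noteq> 0 \<and> real i + s * real j = v1 \<xi> s F})"

definition Delta_s_plus :: "complex fps \<Rightarrow> real \<Rightarrow> (real \<times> real) set" where
  "Delta_s_plus \<xi> s = closure (convex hull
     {(1 / real k) *\<^sub>R vplus \<xi> s F | k F. k \<ge> 1 \<and> F \<noteq> 0 \<and> homogeneous_deg F k})"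

text \<open>Flag valuation for the flag P^2 > C > O; G is a defining form of C, its
  dehomogenisation g = G(x,y,1) is the local equation of C at O.  All computations take
  place in C[[x,w]] (coordinates change y = w + xi(x)).\<close>

definition ord_C :: "complex fps \<Rightarrow> complex poly poly poly \<Rightarrow> complex poly poly poly \<Rightarrow> nat" where
  "ord_C \<xi> G F = (GREATEST m. cexp \<xi> G ^ m dvd cexp \<xi> F)"

definition flag_val :: "complex fps \<Rightarrow> complex poly poly poly \<Rightarrow> complex poly poly poly \<Rightarrow> real \<times> real" where
  "flag_val \<xi> G F = (let m = ord_C \<xi> G F;
      h = (SOME h. cexp \<xi> F = cexp \<xi> G ^ m * h)
    in (real m, real (subdegree (fps_nth h 0))))"

definition NO_body :: "complex fps \<Rightarrow> complex poly poly poly \<Rightarrow> (real \<times> real) set" where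
  "NO_body \<xi> G = closure (convex hull
     {(1 / real k) *\<^sub>R flag_val \<xi> G F | k F. k \<ge> 1 \<and> F \<noteq> 0 \<and> homogeneous_deg F k})"

definition tri :: "real \<Rightarrow> real \<Rightarrow> real \<Rightarrow> (real \<times> real) set" where
  "tri a b c = convex hull {(0, 0), (a, 0), (b, c)}"

end

theory Submission
  imports Defs "HOL-Computational_Algebra.Field_as_Ring"
begin

text \<open>
  In the coordinates \<open>(x, w)\<close> the equation of the curve is \<open>w\<close> times a unit.  Write a form of
  degree \<open>k\<close> as \<open>F = G ^ m * H\<close> with \<open>G\<close> not dividing \<open>H\<close>; by Bezout \<open>H\<close> vanishes along the
  branch to order \<open>n \<le> d (k - m d)\<close>.  So \<open>x ^ n w ^ m\<close> is the lexicographically first term of the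
  expansion of \<open>F\<close>, and \<open>n + d\<^sup>2 m \<le> d k\<close>.  Since \<open>s \<ge> d\<^sup>2\<close>, the term that realises \<open>v\<^sub>+\<close>
  satisfies the same inequality.  Hence both valuations select an exponent \<open>(i, j)\<close> of the expansion
  in the triangle \<open>i + d\<^sup>2 j \<le> d k\<close>, and both bodies are linear images of the triangle with
  vertices \<open>(0, 0)\<close>, \<open>(d, 0)\<close>, \<open>(0, 1/d)\<close>, once its vertices are reached.  The form \<open>Z\<close>
  gives the first and \<open>G\<close> the third; \<open>(d, 0)\<close> is a limit, because the number of forms of degree
  \<open>k\<close> and the number of lattice points of the triangle agree up to \<open>O(k)\<close>.
\<close>

unbundle no vec_syntax

subsection \<open>Linear systems and ring homomorphisms\<close>

text \<open>Gaussian elimination, one equation at a time. Both existence arguments below rest on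
  this count: the relation between forms behind the Bezout bound, and the form supported near a
  corner.\<close>

lemma homogeneous_system_nontrivial_solution:
  fixes M :: "'i \<Rightarrow> 'j \<Rightarrow> 'a::field"
  assumes "finite J" and "finite I" and "card J < card I"
  shows "\<exists>c. (\<exists>i\<in>I. c i \<noteq> 0) \<and> (\<forall>j\<in>J. (\<Sum>i\<in>I. c i * M i j) = 0)"
  using assms
proof (induction J arbitrary: I M rule: finite_induct)
  case empty
  then have "I \<noteq> {}" by auto
  then show ?case by (intro exI[of _ "\<lambda>_. 1"]) auto
next
  case (insert j J)
  show ?case
  proof (cases "\<forall>i\<in>I. M i j = 0")
    case True
    obtain c where "\<exists>i\<in>I. c i \<noteq> 0" "\<forall>j\<in>J. (\<Sum>i\<in>I. c i * M i j) = 0"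
      using insert.IH[of I M] insert.prems insert.hyps by auto
    with True show ?thesis by (intro exI[of _ c]) auto
  next
    case False
    then obtain p where p: "p \<in> I" "M p j \<noteq> 0" by auto
    define N where "N i l = M i l - M i j / M p j * M p l" for i l
    have "card J < card (I - {p})"
      using insert.prems insert.hyps p by simp
    then obtain c where c: "\<exists>i\<in>I-{p}. c i \<noteq> 0" "\<forall>l\<in>J. (\<Sum>i\<in>I-{p}. c i * N i l) = 0"
      using insert.IH[of "I - {p}" N] insert.prems by blast
    \<comment> \<open>\<open>N\<close> is the system after equation \<open>j\<close> has eliminated
      the unknown \<open>p\<close>; \<open>- e\<close> is the value that equation \<open>j\<close>
      then forces on \<open>p\<close>.\<close>
    define e where "e = (\<Sum>i\<in>I-{p}. c i * M i j) / M p j"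
    define c' where "c' = c(p := - e)"
    have split: "(\<Sum>i\<in>I. c' i * M i l) = (\<Sum>i\<in>I-{p}. c i * M i l) - e * M p l" for l
    proof -
      have "(\<Sum>i\<in>I. c' i * M i l) = c' p * M p l + (\<Sum>i\<in>I-{p}. c' i * M i l)"
        using insert.prems p by (simp add: sum.remove)
      also have "(\<Sum>i\<in>I-{p}. c' i * M i l) = (\<Sum>i\<in>I-{p}. c i * M i l)"
        by (intro sum.cong) (auto simp: c'_def)
      finally show ?thesis by (simp add: c'_def)
    qed
    have "(\<Sum>i\<in>I. c' i * M i l) = 0" if "l \<in> insert j J" for l
    proof (cases "l = j")
      case True
      then show ?thesis using p by (simp add: split e_def)
    next
      case False
      then have "0 = (\<Sum>i\<in>I-{p}. c i * N i l)" using c that by auto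
      also have "\<dots> = (\<Sum>i\<in>I-{p}. c i * M i l) - (\<Sum>i\<in>I-{p}. c i * M i j / M p j * M p l)"
        by (simp add: N_def algebra_simps sum_subtractf)
      also have "(\<Sum>i\<in>I-{p}. c i * M i j / M p j * M p l) = e * M p l"
        by (simp add: e_def sum_distrib_right sum_divide_distrib)
      finally show ?thesis by (simp add: split)
    qed
    moreover have "\<exists>i\<in>I. c' i \<noteq> 0" using c(1) by (auto simp: c'_def)
    ultimately show ?thesis by blast
  qed
qed

section \<open>Evaluation homomorphisms\<close>

definition coeffwise_eval :: "('a::comm_ring_1 \<Rightarrow> 'b::comm_ring_1) \<Rightarrow> 'b \<Rightarrow> 'a poly \<Rightarrow> 'b" where
  "coeffwise_eval h x p = (\<Sum>i\<le>degree p. h (coeff p i) * x ^ i)"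

locale unital_ring_hom =
  fixes h :: "'a::comm_ring_1 \<Rightarrow> 'b::comm_ring_1"
  assumes add: "h (a + b) = h a + h b"
    and mult: "h (a * b) = h a * h b"
    and one: "h 1 = 1"
begin

lemma zero: "h 0 = 0"
  using add[of 0 0] by simp

lemma sum: "h (\<Sum>i\<in>A. f i) = (\<Sum>i\<in>A. h (f i))"
  by (induction A rule: infinite_finite_induct) (auto simp: add zero)

lemma power: "h (a ^ n) = h a ^ n"
  by (induction n) (auto simp: one mult)

lemma coeffwise_eval_upto:
  assumes "degree p \<le> N"
  shows "coeffwise_eval h x p = (\<Sum>i\<le>N. h (coeff p i) * x ^ i)"
  unfolding coeffwise_eval_def
  by (rule sum.mono_neutral_left) (use assms in \<open>auto simp: coeff_eq_0 zero\<close>)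

lemma coeffwise_eval_pCons:
  "coeffwise_eval h x (pCons a p) = h a + x * coeffwise_eval h x p"
proof -
  have "coeffwise_eval h x (pCons a p) = (\<Sum>i\<le>Suc (degree p). h (coeff (pCons a p) i) * x ^ i)"
    by (rule coeffwise_eval_upto) (rule degree_pCons_le)
  also have "\<dots> = h a + (\<Sum>i\<le>degree p. h (coeff p i) * x ^ Suc i)"
    by (subst sum.atMost_Suc_shift) simp
  finally show ?thesis
    by (simp add: coeffwise_eval_def sum_distrib_left mult_ac)
qed

lemma coeffwise_eval_add:
  "coeffwise_eval h x (p + q) = coeffwise_eval h x p + coeffwise_eval h x q"
  using degree_add_le_max[of p q]
  by (simp add: coeffwise_eval_upto[of _ "max (degree p) (degree q)"] add ring_distribs sum.distrib)

lemma coeffwise_eval_smult: "coeffwise_eval h x (smult a p) = h a * coeffwise_eval h x p"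
  by (simp add: coeffwise_eval_upto[of _ "degree p"] degree_smult_le mult sum_distrib_left mult_ac)

lemma unital_ring_hom_coeffwise_eval: "unital_ring_hom (coeffwise_eval h x)"
proof
  show "coeffwise_eval h x (p * q) = coeffwise_eval h x p * coeffwise_eval h x q" for p q
  proof (induction p)
    case 0
    then show ?case by (simp add: coeffwise_eval_def zero)
  next
    case (pCons a p)
    then show ?case
      by (simp add: coeffwise_eval_add coeffwise_eval_smult coeffwise_eval_pCons zero
          algebra_simps)
  qed
qed (simp_all add: coeffwise_eval_add, simp add: coeffwise_eval_def one)

end

text \<open>\<open>cexp\<close> is an iterated evaluation: Z at 1, then Y at w + xi, then X at x,
  each extending the previous homomorphism.\<close>

lemma unital_ring_hom_cexp: "unital_ring_hom (cexp \<xi>)"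
proof -
  define h0 :: "complex poly \<Rightarrow> complex fps fps" where "h0 q = fps_const (fps_const (poly q 1))" for q
  interpret h0: unital_ring_hom h0
    by standard (simp_all add: h0_def)
  let ?h1 = "coeffwise_eval h0 (fps_X + fps_const \<xi>)"
  interpret h1: unital_ring_hom ?h1
    by (rule h0.unital_ring_hom_coeffwise_eval)
  have "cexp \<xi> = coeffwise_eval ?h1 (fps_const fps_X)"
    by (auto simp: fun_eq_iff cexp_def coeffwise_eval_def h0_def sum_distrib_right sum_distrib_left
        fps_const_power mult_ac simp flip: fps_const_mult intro!: sum.cong)
  then show ?thesis using h1.unital_ring_hom_coeffwise_eval by simp
qed

interpretation cexp: unital_ring_hom "cexp \<xi>" for \<xi>
  by (rule unital_ring_hom_cexp)

subsection \<open>Ternary forms\<close>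

definition hmonom :: "complex \<Rightarrow> nat \<Rightarrow> nat \<Rightarrow> nat \<Rightarrow> complex poly poly poly" where
  "hmonom z a b c = monom (monom (monom z c) b) a"

lemma cexp_hmonom: "cexp \<xi> (hmonom z a b c) =
    fps_const (fps_const z * fps_X ^ a) * (fps_X + fps_const \<xi>) ^ b"
proof (cases "z = 0")
  case True
  then show ?thesis by (simp add: hmonom_def cexp.zero)
next
  case False
  have "(\<Sum>i\<le>a. \<Sum>j\<le>degree (coeff (monom (monom (monom z c) b) a) i).
      fps_const (fps_const (poly (coeff (coeff (monom (monom (monom z c) b) a) i) j) 1) * fps_X ^ i)
        * (fps_X + fps_const \<xi>) ^ j) =
    (\<Sum>i\<le>a. if i = a then fps_const (fps_const z * fps_X ^ a) * (fps_X + fps_const \<xi>) ^ b else 0)"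
  proof (intro sum.cong refl, goal_cases)
    case (1 i)
    have "(\<Sum>j\<le>b. fps_const (fps_const (poly (coeff (monom (monom z c) b) j) 1) * fps_X ^ a)
        * (fps_X + fps_const \<xi>) ^ j) =
      (\<Sum>j\<le>b. if j = b then fps_const (fps_const z * fps_X ^ a) * (fps_X + fps_const \<xi>) ^ b else 0)"
      by (intro sum.cong refl) (auto simp: poly_monom)
    with False show ?case by (auto simp: degree_monom_eq)
  qed
  with False show ?thesis
    by (simp add: cexp_def hmonom_def degree_monom_eq)
qed

lemma hcoeff_hmonom:
  "hcoeff (hmonom z a b c) i j l = (if a = i \<and> b = j \<and> c = l then z else 0)"
  by (simp add: hcoeff_def hmonom_def)

lemma hcoeff_eqI: "(\<And>a b c. hcoeff F a b c = hcoeff H a b c) \<Longrightarrow> F = H"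
  by (simp add: hcoeff_def poly_eq_iff)

lemma hcoeff_add: "hcoeff (F + H) a b c = hcoeff F a b c + hcoeff H a b c"
  by (simp add: hcoeff_def)

lemma hcoeff_sum: "hcoeff (\<Sum>i\<in>A. f i) a b c = (\<Sum>i\<in>A. hcoeff (f i) a b c)"
  by (simp add: hcoeff_def coeff_sum)

lemma hcoeff_mult:
  "hcoeff (F * H) a b c =
    (\<Sum>i\<le>a. \<Sum>j\<le>b. \<Sum>l\<le>c. hcoeff F i j l * hcoeff H (a - i) (b - j) (c - l))"
  by (simp add: hcoeff_def coeff_mult coeff_sum)

lemma homogeneous_deg_mult:
  assumes "homogeneous_deg F k" "homogeneous_deg H l"
  shows "homogeneous_deg (F * H) (k + l)"
  unfolding homogeneous_deg_def
proof (intro allI impI)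
  fix a b c assume "hcoeff (F * H) a b c \<noteq> 0"
  then obtain i j m where *: "i \<le> a" "j \<le> b" "m \<le> c"
      "hcoeff F i j m * hcoeff H (a - i) (b - j) (c - m) \<noteq> 0"
    unfolding hcoeff_mult by (metis (no_types, lifting) atMost_iff sum.not_neutral_contains_not_neutral)
  then have "i + j + m = k" "(a - i) + (b - j) + (c - m) = l"
    using assms unfolding homogeneous_deg_def by (metis mult_zero_left, metis mult_zero_right)
  with * show "a + b + c = k + l" by linarith
qed

lemma homogeneous_deg_add:
  "homogeneous_deg F k \<Longrightarrow> homogeneous_deg H k \<Longrightarrow> homogeneous_deg (F + H) k"
  unfolding homogeneous_deg_def by (metis add_0 hcoeff_add)

lemma homogeneous_deg_0: "homogeneous_deg 0 k"
  by (simp add: homogeneous_deg_def hcoeff_def)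

lemma homogeneous_deg_sum:
  "(\<And>i. i \<in> A \<Longrightarrow> homogeneous_deg (f i) k) \<Longrightarrow> homogeneous_deg (\<Sum>i\<in>A. f i) k"
  by (induction A rule: infinite_finite_induct)
     (auto intro: homogeneous_deg_add simp: homogeneous_deg_0)

lemma homogeneous_deg_hmonom: "homogeneous_deg (hmonom z a b c) (a + b + c)"
  by (auto simp: homogeneous_deg_def hcoeff_hmonom split: if_splits)

lemma hmonom_scale: "hmonom z a b c = hmonom z 0 0 0 * hmonom 1 a b c"
  by (simp add: hmonom_def mult_monom)

section \<open>Spaces of forms and their dimension\<close>

definition hexps :: "nat \<Rightarrow> (nat \<times> nat) set" where
  "hexps k = Sigma {..k} (\<lambda>a. {..k - a})"

text \<open>The degree \<open>k\<close> determines the exponent of Z. The index set \<open>A\<close>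
  varies because normal forms modulo \<open>G\<close> use only part of the monomials.\<close>

definition hform :: "nat \<Rightarrow> (nat \<times> nat) set \<Rightarrow> (nat \<times> nat \<Rightarrow> complex) \<Rightarrow> complex poly poly poly" where
  "hform k A c = (\<Sum>p\<in>A. hmonom (c p) (fst p) (snd p) (k - fst p - snd p))"

lemma finite_hexps [simp]: "finite (hexps k)"
  by (simp add: hexps_def)

lemma mem_hexps: "(a, b) \<in> hexps k \<longleftrightarrow> a + b \<le> k"
  by (auto simp: hexps_def)

lemma card_hexps: "2 * card (hexps k) = (k + 1) * (k + 2)"
proof -
  have "card (hexps k) = (\<Sum>a\<le>k. Suc (k - a))"
    by (simp add: hexps_def)
  also have "\<dots> = (\<Sum>a\<le>k. Suc a)"
    using sum.nat_diff_reindex[of Suc "Suc k"] by (simp add: lessThan_Suc_atMost)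
  also have "2 * \<dots> = (k + 1) * (k + 2)"
    by (induction k) auto
  finally show ?thesis .
qed

lemma homogeneous_deg_hform:
  assumes "A \<subseteq> hexps k"
  shows "homogeneous_deg (hform k A c) k"
  unfolding hform_def
proof (rule homogeneous_deg_sum)
  fix p assume "p \<in> A"
  then have "fst p + snd p \<le> k" using assms mem_hexps[of "fst p" "snd p" k] by auto
  then show "homogeneous_deg (hmonom (c p) (fst p) (snd p) (k - fst p - snd p)) k"
    using homogeneous_deg_hmonom[of "c p" "fst p" "snd p" "k - fst p - snd p"] by simp
qed

lemma hcoeff_hform:
  assumes "A \<subseteq> hexps k"
  shows "hcoeff (hform k A c) a b l = (if (a, b) \<in> A \<and> l = k - a - b then c (a, b) else 0)"
proof -
  have fin: "finite A" by (rule finite_subset[OF assms finite_hexps])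
  have "hcoeff (hform k A c) a b l =
      (\<Sum>p\<in>A. if p = (a, b) then (if l = k - a - b then c (a, b) else 0) else 0)"
    unfolding hform_def hcoeff_sum by (intro sum.cong) (auto simp: hcoeff_hmonom)
  then show ?thesis using fin by simp
qed

lemma hform_eq_0D:
  assumes "hform k A c = 0" "A \<subseteq> hexps k" "p \<in> A"
  shows "c p = 0"
  using hcoeff_hform[OF assms(2), of c "fst p" "snd p" "k - fst p - snd p"] assms(1,3)
  by (simp add: hcoeff_def)

text \<open>A form of degree \<open>k\<close> is a vector with \<open>card (hexps k)\<close>
  coordinates, so more forms than that satisfy a relation. Scalars appear as constants
  \<open>hmonom (c i) 0 0 0\<close>.\<close>

lemma forms_linearly_dependent:
  assumes "finite I" and "\<And>i. i \<in> I \<Longrightarrow> homogeneous_deg (P i) k" and "card (hexps k) < card I"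
  shows "\<exists>c. (\<exists>i\<in>I. c i \<noteq> 0) \<and> (\<Sum>i\<in>I. hmonom (c i) 0 0 0 * P i) = 0"
proof -
  obtain c where c: "\<exists>i\<in>I. c i \<noteq> 0"
      "\<forall>p\<in>hexps k. (\<Sum>i\<in>I. c i * hcoeff (P i) (fst p) (snd p) (k - fst p - snd p)) = 0"
    using homogeneous_system_nontrivial_solution[of "hexps k" I
        "\<lambda>i p. hcoeff (P i) (fst p) (snd p) (k - fst p - snd p)"] assms
    by auto
  have scale: "hcoeff (hmonom z 0 0 0 * F) a b l = z * hcoeff F a b l" for z F a b l
    by (simp add: hcoeff_def hmonom_def monom_0)
  have "(\<Sum>i\<in>I. hmonom (c i) 0 0 0 * P i) = 0"
  proof (rule hcoeff_eqI)
    fix a b l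
    have "(\<Sum>i\<in>I. c i * hcoeff (P i) a b l) = 0"
    proof (cases "a + b + l = k")
      case True
      then have "(a, b) \<in> hexps k" "l = k - a - b" by (auto simp: mem_hexps)
      then show ?thesis using c(2) by force
    next
      case False
      then have "hcoeff (P i) a b l = 0" if "i \<in> I" for i
        using assms(2)[OF that] by (auto simp: homogeneous_deg_def)
      then show ?thesis by simp
    qed
    then show "hcoeff (\<Sum>i\<in>I. hmonom (c i) 0 0 0 * P i) a b l = hcoeff 0 a b l"
      by (simp add: hcoeff_sum scale) (simp add: hcoeff_def)
  qed
  with c show ?thesis by blast
qed

lemma homogeneous_cofactor:
  assumes F: "homogeneous_deg (G * H) k" and G: "homogeneous_deg G d" and nz: "G * H \<noteq> 0"
  shows "d \<le> k" and "homogeneous_deg H (k - d)"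
proof -
  show "d \<le> k"
  proof -
    obtain a b c where "hcoeff (G * H) a b c \<noteq> 0"
      using nz hcoeff_eqI[of "G * H" 0] by (auto simp: hcoeff_def)
    moreover from this obtain i j m where *: "i \<le> a" "j \<le> b" "m \<le> c" "hcoeff G i j m \<noteq> 0"
      unfolding hcoeff_mult
      by (metis (no_types, lifting) atMost_iff mult_eq_0_iff sum.not_neutral_contains_not_neutral)
    ultimately have "a + b + c = k" "i + j + m = d" using F G by (auto simp: homogeneous_deg_def)
    with * show ?thesis by linarith
  qed
  \<comment> \<open>The component of degree \<open>k - d\<close> of \<open>H\<close> has the same product with \<open>G\<close>, so it is \<open>H\<close>.\<close>
  define K where "K = hform (k - d) (hexps (k - d)) (\<lambda>p. hcoeff H (fst p) (snd p) (k - d - fst p - snd p))"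
  have K: "homogeneous_deg K (k - d)" unfolding K_def by (rule homogeneous_deg_hform) simp
  have Kc: "hcoeff K a b c = (if a + b + c = k - d then hcoeff H a b c else 0)" for a b c
    by (auto simp: K_def hcoeff_hform mem_hexps)
  have GK: "homogeneous_deg (G * K) k"
    using homogeneous_deg_mult[OF G K] \<open>d \<le> k\<close> by simp
  have "G * K = G * H"
  proof (rule hcoeff_eqI)
    fix a b c
    show "hcoeff (G * K) a b c = hcoeff (G * H) a b c"
    proof (cases "a + b + c = k")
      case False
      then show ?thesis using F GK unfolding homogeneous_deg_def by metis
    next
      case True
      have "hcoeff G i j l * hcoeff K (a - i) (b - j) (c - l) =
          hcoeff G i j l * hcoeff H (a - i) (b - j) (c - l)" if "i \<le> a" "j \<le> b" "l \<le> c" for i j l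
      proof (cases "hcoeff G i j l = 0")
        case False
        then have "i + j + l = d" using G by (auto simp: homogeneous_deg_def)
        then have "(a - i) + (b - j) + (c - l) = k - d" using True that by linarith
        then show ?thesis by (simp add: Kc)
      qed simp
      then show ?thesis unfolding hcoeff_mult by (intro sum.cong) auto
    qed
  qed
  then have "K = H" using nz by auto
  with K show "homogeneous_deg H (k - d)" by simp
qed

lemma homogeneous_eq_hform:
  assumes "homogeneous_deg F k"
  shows "F = hform k (hexps k) (\<lambda>p. hcoeff F (fst p) (snd p) (k - fst p - snd p))"
proof (rule hcoeff_eqI)
  fix a b c
  show "hcoeff F a b c = hcoeff (hform k (hexps k)
      (\<lambda>p. hcoeff F (fst p) (snd p) (k - fst p - snd p))) a b c"
  proof (cases "hcoeff F a b c = 0")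
    case False
    then have "a + b + c = k" using assms by (auto simp: homogeneous_deg_def)
    then show ?thesis by (auto simp: hcoeff_hform mem_hexps)
  qed (auto simp: hcoeff_hform)
qed

text \<open>Leading exponents for the lexicographic order X > Y > Z add up in products over a
  domain. So the leading monomial of a nonzero multiple of \<open>G\<close> is divisible by that of
  \<open>G\<close>, and \<open>normal\<close> excludes such monomials.\<close>

lemma multiple_in_normal_form_eq_0:
  fixes B G :: "complex poly poly poly"
  assumes "G dvd B" and "G \<noteq> 0"
    and normal: "\<And>i j l. \<lbrakk>degree G \<le> i; degree (lead_coeff G) \<le> j;
      degree (lead_coeff (lead_coeff G)) \<le> l\<rbrakk> \<Longrightarrow> hcoeff B i j l = 0"
  shows "B = 0"
proof (rule ccontr)
  assume "B \<noteq> 0"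
  obtain Q where Q: "B = G * Q" using assms by auto
  with \<open>B \<noteq> 0\<close> have "Q \<noteq> 0" by auto
  have "hcoeff B (degree B) (degree (lead_coeff B)) (degree (lead_coeff (lead_coeff B))) \<noteq> 0"
    using \<open>B \<noteq> 0\<close> by (simp add: hcoeff_def)
  moreover have "degree G \<le> degree B" "degree (lead_coeff G) \<le> degree (lead_coeff B)"
    "degree (lead_coeff (lead_coeff G)) \<le> degree (lead_coeff (lead_coeff B))"
    unfolding Q lead_coeff_mult using \<open>G \<noteq> 0\<close> \<open>Q \<noteq> 0\<close> by (simp_all add: degree_mult_eq)
  ultimately show False using normal by blast
qed

subsection \<open>Intersection multiplicity with a branch\<close>

text \<open>Setting w = 0 means y = xi(x), so this is F(x, xi(x), 1); its order is the local
  intersection multiplicity with the branch.\<close>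

definition restrict_to_branch :: "complex fps \<Rightarrow> complex poly poly poly \<Rightarrow> complex fps" where
  "restrict_to_branch \<xi> F = fps_nth (cexp \<xi> F) 0"

interpretation restr: unital_ring_hom "restrict_to_branch \<xi>" for \<xi>
  by standard (simp_all add: restrict_to_branch_def cexp.add cexp.mult cexp.one)

lemma restrict_to_branch_hmonom:
  "restrict_to_branch \<xi> (hmonom z a b c) = fps_const z * fps_X ^ a * \<xi> ^ b"
  by (simp add: restrict_to_branch_def cexp_hmonom fps_power_zeroth)

text \<open>The monomials removed are the multiples of X^a Y^b Z^c, and their exponents form a
  translate of \<open>hexps n\<close>.\<close>

lemma card_normal_form_exps:
  assumes "a + b + c = d"
  shows "card {(i, j) \<in> hexps (n + d). \<not> (a \<le> i \<and> b \<le> j \<and> c \<le> n + d - i - j)} + card (hexps n)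
    = card (hexps (n + d))" (is "card ?U + _ = _")
proof -
  let ?g = "\<lambda>(i, j). (i + a, j + b)"
  have "hexps (n + d) = ?U \<union> ?g ` hexps n"
  proof (intro equalityI subsetI)
    fix p assume p: "p \<in> hexps (n + d)"
    obtain i j where ij: "p = (i, j)" by force
    show "p \<in> ?U \<union> ?g ` hexps n"
    proof (cases "p \<in> ?U")
      case False
      then have "a \<le> i" "b \<le> j" "c \<le> n + d - i - j" "i + j \<le> n + d"
        using p ij by (auto simp: mem_hexps)
      then have "(i - a, j - b) \<in> hexps n" "p = ?g (i - a, j - b)"
        using assms ij by (auto simp: mem_hexps)
      then show ?thesis by blast
    qed simp
  qed (use assms in \<open>auto simp: mem_hexps\<close>)
  moreover have "?U \<inter> ?g ` hexps n = {}"
    using assms by (auto simp: mem_hexps)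
  moreover have "finite ?U" by (rule finite_subset[of _ "hexps (n + d)"]) auto
  ultimately have "card (hexps (n + d)) = card ?U + card (?g ` hexps n)"
    using card_Un_disjoint[of ?U "?g ` hexps n"] by (metis finite_hexps finite_imageI)
  moreover have "inj_on ?g (hexps n)" by (auto simp: inj_on_def)
  ultimately show ?thesis by (simp add: card_image)
qed

lemma acoef_sum: "acoef \<xi> (\<Sum>p\<in>A. f p) i j = (\<Sum>p\<in>A. acoef \<xi> (f p) i j)"
  by (simp add: acoef_def cexp.sum fps_sum_nth)

lemma acoef_hmonom: "acoef \<xi> (hmonom z a b c) i j = z * acoef \<xi> (hmonom 1 a b c) i j"
  by (simp add: acoef_def cexp_hmonom mult.assoc del: fps_const_mult)

text \<open>\<open>smooth\<close> says that the y-derivative of G(x, y, 1) at O is not zero, and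
  \<open>branch_on_curve\<close> that G(x, xi(x), 1) = 0.\<close>

locale plane_branch =
  fixes G :: "complex poly poly poly" and d :: nat and \<xi> :: "complex fps"
  assumes hom_G: "homogeneous_deg G d"
    and irred_G: "irreducible G"
    and smooth: "hcoeff G 0 1 (d - 1) \<noteq> 0"
    and branch_origin: "fps_nth \<xi> 0 = 0"
    and branch_on_curve: "fps_nth (cexp \<xi> G) 0 = 0"
begin

abbreviation rho :: "complex poly poly poly \<Rightarrow> complex fps" where
  "rho \<equiv> restrict_to_branch \<xi>"

lemma d_pos: "d \<ge> 1"
proof -
  \<comment> \<open>For d = 0 the truncated difference would be 0 and homogeneity would read 1 =
    0.\<close>
  have "0 + 1 + (d - 1) = d" using hom_G smooth unfolding homogeneous_deg_def by blast
  then show ?thesis by linarith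
qed

lemma G_nonzero: "G \<noteq> 0"
  using irred_G by auto

lemma prime_G: "prime_elem G"
  using irred_G by (rule irreducible_imp_prime_elem)

text \<open>Linear algebra replaces Bezout's theorem: if \<open>H\<close> vanished to order above \<open>d e\<close> along the
  branch, then \<open>A G + B H + C(X, Z)\<close>, with \<open>B\<close> in normal form modulo \<open>G\<close> and \<open>C\<close> of degree at
  most \<open>d e\<close> in \<open>X\<close>, would be a family of forms of one degree with one parameter more than
  the dimension of the space of these forms, yet without a nontrivial relation.\<close>

lemma intersection_multiplicity_le:
  assumes H: "homogeneous_deg H e" and ndvd: "\<not> G dvd H"
  shows "rho H \<noteq> 0" and "subdegree (rho H) \<le> d * e"
proof -
  have "rho H \<noteq> 0 \<and> subdegree (rho H) \<le> d * e"
  proof (rule ccontr)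
    assume "\<not> ?thesis"
    \<comment> \<open>Both ways to fail, \<open>rho H = 0\<close> and too large an order, give the
      same vanishing.\<close>
    then have van: "rho H $ i = 0" if "i \<le> d * e" for i
      using that by (cases "rho H = 0") (auto intro: nth_less_subdegree_zero)
    \<comment> \<open>In this degree the cofactors \<open>A\<close> and \<open>B\<close> have
      degrees \<open>d * e + e\<close> and \<open>d * e + d\<close>, and X^i Z^(k-i) exists for all
      \<open>i \<le> d * e\<close>.\<close>
    define k where "k = d * e + d + e"
    define a where "a = degree G"
    define b where "b = degree (lead_coeff G)"
    define c where "c = degree (lead_coeff (lead_coeff G))"
    have "hcoeff G a b c \<noteq> 0"
      using G_nonzero by (simp add: hcoeff_def a_def b_def c_def)
    then have abc: "a + b + c = d" using hom_G by (auto simp: homogeneous_deg_def)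
    define U where "U = {(i, j) \<in> hexps (d * e + d). \<not> (a \<le> i \<and> b \<le> j \<and> c \<le> d * e + d - i - j)}"
    have U_sub: "U \<subseteq> hexps (d * e + d)" by (auto simp: U_def)
    have fin_U: "finite U" by (rule finite_subset[OF U_sub finite_hexps])
    define I where "I = hexps (d * e + e) <+> (U <+> {..d * e})"
    define P where "P = case_sum (\<lambda>p. hmonom 1 (fst p) (snd p) (d * e + e - fst p - snd p) * G)
      (case_sum (\<lambda>p. hmonom 1 (fst p) (snd p) (d * e + d - fst p - snd p) * H)
        (\<lambda>i. hmonom 1 i 0 (k - i)))"
    have "homogeneous_deg (P x) k" if "x \<in> I" for x
    proof -
      consider (A) i j where "x = Inl (i, j)" "(i, j) \<in> hexps (d * e + e)"
        | (B) i j where "x = Inr (Inl (i, j))" "(i, j) \<in> hexps (d * e + d)"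
        | (C) i where "x = Inr (Inr i)" "i \<le> d * e"
        using \<open>x \<in> I\<close> U_sub unfolding I_def by auto
      then show ?thesis
      proof cases
        case A
        then have "i + j + (d * e + e - i - j) = d * e + e" by (simp add: mem_hexps)
        then show ?thesis
          using homogeneous_deg_mult[OF homogeneous_deg_hmonom[of 1 i j "d * e + e - i - j"] hom_G] A
          by (simp add: P_def k_def ac_simps)
      next
        case B
        then have "i + j + (d * e + d - i - j) = d * e + d" by (simp add: mem_hexps)
        then show ?thesis
          using homogeneous_deg_mult[OF homogeneous_deg_hmonom[of 1 i j "d * e + d - i - j"] H] B
          by (simp add: P_def k_def ac_simps)
      next
        case C
        then show ?thesis
          using homogeneous_deg_hmonom[of 1 i 0 "k - i"] by (simp add: P_def k_def)
      qed
    qed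
    moreover have "finite I" using fin_U by (simp add: I_def)
    moreover have "card (hexps k) < card I"
    proof -
      have cI: "card I = card (hexps (d * e + e)) + (card U + (d * e + 1))"
        using fin_U by (simp add: I_def card_Plus)
      have cU: "card U + card (hexps (d * e)) = card (hexps (d * e + d))"
        unfolding U_def using card_normal_form_exps[OF abc] by simp
      have arith: "2 * q + Z = X + Y + 2 * N"
        if "q = x + (u + N)" "u + z = y" "2 * x = X" "2 * y = Y" "2 * z = Z"
        for q x y z u X Y Z N :: nat
        using that by linarith
      have "2 * card I + (d * e + 1) * (d * e + 2) =
          (d * e + e + 1) * (d * e + e + 2) + (d * e + d + 1) * (d * e + d + 2) + 2 * (d * e + 1)"
        by (rule arith[OF cI cU card_hexps card_hexps card_hexps])
      \<comment> \<open>The terms 2 d e cancel; the final 2 in this doubled count is the one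
        parameter in excess.\<close>
      also have "\<dots> = (k + 1) * (k + 2) + (d * e + 1) * (d * e + 2) + 2"
        by (simp add: k_def algebra_simps)
      finally show ?thesis using card_hexps[of k] by linarith
    qed
    ultimately obtain f where f: "\<exists>i\<in>I. f i \<noteq> 0" and
        rel: "(\<Sum>i\<in>I. hmonom (f i) 0 0 0 * P i) = 0"
      using forms_linearly_dependent[of I P k] by auto
    define A where "A = hform (d * e + e) (hexps (d * e + e)) (\<lambda>p. f (Inl p))"
    define B where "B = hform (d * e + d) U (\<lambda>p. f (Inr (Inl p)))"
    define C where "C = (\<Sum>i\<le>d * e. hmonom (f (Inr (Inr i))) i 0 (k - i))"
    have "(\<Sum>i\<in>I. hmonom (f i) 0 0 0 * P i) = A * G + (B * H + C)"
      unfolding I_def A_def B_def C_def hform_def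
      by (simp add: sum.Plus fin_U P_def sum_distrib_right
          flip: hmonom_scale mult.assoc)
    with rel have ABC: "A * G + (B * H + C) = 0" by simp
    have rho_C: "rho C $ i = (if i \<le> d * e then f (Inr (Inr i)) else 0)" for i
    proof -
      have "rho C $ i = (\<Sum>j\<le>d * e. if j = i then f (Inr (Inr i)) else 0)"
        unfolding C_def restr.sum fps_sum_nth
        by (intro sum.cong) (auto simp: restrict_to_branch_hmonom)
      then show ?thesis by simp
    qed
    \<comment> \<open>On the branch \<open>A * G\<close> vanishes, \<open>B * H\<close> starts
      beyond order \<open>d * e\<close>, and \<open>C\<close> is a polynomial in x of degree at most
      \<open>d * e\<close>; so \<open>C\<close> must vanish.\<close>
    have "rho (A * G + (B * H + C)) = 0" by (simp add: ABC restr.zero)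
    then have "rho B * rho H + rho C = 0"
      using branch_on_curve by (simp add: restr.add restr.mult restrict_to_branch_def[of \<xi> G])
    then have "(rho B * rho H) $ i + rho C $ i = 0" for i
      by (metis fps_add_nth fps_zero_nth)
    moreover have "(rho B * rho H) $ i = 0" if "i \<le> d * e" for i
      using that by (auto simp: fps_mult_nth van)
    ultimately have fC: "f (Inr (Inr i)) = 0" if "i \<le> d * e" for i
      using that rho_C[of i] by (metis add_0)
    then have "C = 0" by (auto simp: C_def hmonom_def)
    with ABC have AB: "A * G + B * H = 0" by simp
    then have "B * H = G * (- A)" by (simp add: algebra_simps eq_neg_iff_add_eq_0)
    then have "G dvd B * H" by simp
    with ndvd prime_G have "G dvd B" using prime_elem_dvd_mult_iff by blast
    moreover have "hcoeff B i j l = 0" if "a \<le> i" "b \<le> j" "c \<le> l" for i j l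
      unfolding B_def hcoeff_hform[OF U_sub] using that by (auto simp: U_def)
    ultimately have "B = 0"
      using multiple_in_normal_form_eq_0[of G B] G_nonzero by (simp add: a_def b_def c_def)
    with AB G_nonzero have "A = 0" by simp
    have "f (Inl p) = 0" if "p \<in> hexps (d * e + e)" for p
      using hform_eq_0D[of "d * e + e" "hexps (d * e + e)" "\<lambda>p. f (Inl p)" p] \<open>A = 0\<close> that
      by (simp add: A_def)
    moreover have "f (Inr (Inl p)) = 0" if "p \<in> U" for p
      using hform_eq_0D[of "d * e + d" U "\<lambda>p. f (Inr (Inl p))" p] \<open>B = 0\<close> that U_sub
      by (simp add: B_def)
    ultimately have "\<forall>i\<in>I. f i = 0" using fC by (auto simp: I_def)
    with f show False by blast
  qed
  then show "rho H \<noteq> 0" "subdegree (rho H) \<le> d * e" by auto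
qed

text \<open>Induction on the degree: each division by \<open>G\<close> lowers it by
  \<open>d \<ge> 1\<close>. Once \<open>G\<close> no longer divides, the Bezout bound applies to the
  remaining factor of degree k - m d.\<close>

lemma factor_out_curve:
  assumes "homogeneous_deg F k" "F \<noteq> 0"
  obtains m H where "F = G ^ m * H" "m * d \<le> k" "rho H \<noteq> 0" "subdegree (rho H) \<le> d * (k - m * d)"
  using assms
proof (induction k arbitrary: F thesis rule: less_induct)
  case (less k)
  show ?case
  proof (cases "G dvd F")
    case False
    then show ?thesis
      using intersection_multiplicity_le[OF less.prems(2) False] less.prems(1)[of 0 F] by simp
  next
    case True
    then obtain F' where F': "F = G * F'" by auto
    have "d \<le> k" "homogeneous_deg F' (k - d)"
      using homogeneous_cofactor[of G F' k d] F' less.prems hom_G by auto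
    moreover have "k - d < k" using d_pos \<open>d \<le> k\<close> by simp
    moreover have "F' \<noteq> 0" using F' less.prems by auto
    ultimately obtain m H where "F' = G ^ m * H" "m * d \<le> k - d" "rho H \<noteq> 0"
        "subdegree (rho H) \<le> d * (k - d - m * d)"
      using less.IH by blast
    with \<open>d \<le> k\<close> show ?thesis
      by (intro less.prems(1)[of "Suc m" H]) (auto simp: F' mult.assoc)
  qed
qed

section \<open>Local equation of the curve at O\<close>

definition cofactor :: "complex fps fps" where
  "cofactor = fps_shift 1 (cexp \<xi> G)"

lemma cexp_G: "cexp \<xi> G = fps_X * cofactor"
  by (rule fps_ext) (simp add: cofactor_def branch_on_curve)

text \<open>Since xi(0) = 0, after substituting y = w + xi(x) only the monomial Y Z^(d-1)
  contributes to the coefficient of x^0 w^1.\<close>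

lemma acoef_G_01: "acoef \<xi> G 0 1 = hcoeff G 0 1 (d - 1)"
proof -
  have pow: "((fps_X + fps_const \<xi>) ^ b) $ 1 $ 0 = (if b = 1 then 1 else 0)" for b
    by (cases b) (auto simp: fps_mult_nth_1 fps_power_zeroth branch_origin)
  have nth_10: "cexp \<xi> (hmonom z a b c) $ 1 $ 0 = (if (a, b) = (0, 1) then z else 0)" for z a b c
    unfolding cexp_hmonom fps_mult_left_const_nth fps_mult_nth_0 pow by (simp add: fps_X_power_nth)
  define q where "q p = hcoeff G (fst p) (snd p) (d - fst p - snd p)" for p
  have "cexp \<xi> G = (\<Sum>p\<in>hexps d. cexp \<xi> (hmonom (q p) (fst p) (snd p) (d - fst p - snd p)))"
    using homogeneous_eq_hform[OF hom_G] unfolding hform_def q_def cexp.sum[symmetric] by simp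
  then have "acoef \<xi> G 0 1 =
      (\<Sum>p\<in>hexps d. cexp \<xi> (hmonom (q p) (fst p) (snd p) (d - fst p - snd p)) $ 1 $ 0)"
    by (simp add: acoef_def fps_sum_nth)
  also have "\<dots> = (\<Sum>p\<in>hexps d. if p = (0, 1) then q p else 0)"
    by (intro sum.cong) (auto simp: nth_10 simp del: One_nat_def)
  also have "\<dots> = q (0, 1)" using d_pos by (simp add: mem_hexps)
  finally show ?thesis by (simp add: q_def)
qed

text \<open>So \<open>cofactor\<close> is a unit, and the curve is w = 0 in the local
  coordinates.\<close>

lemma cofactor_00: "cofactor $ 0 $ 0 \<noteq> 0"
  using acoef_G_01 smooth by (simp add: cofactor_def acoef_def)

subsection \<open>Values of the two valuations\<close>

lemma nth_cexp_G_power_mult: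
  "(cexp \<xi> G ^ m * h) $ j = (if j < m then 0 else (cofactor ^ m * h) $ (j - m))"
  by (simp add: cexp_G power_mult_distrib mult.assoc fps_X_power_mult_nth)

lemma subdegree_nth_cexp_G_power_mult:
  assumes "h $ 0 \<noteq> 0"
  shows "(cexp \<xi> G ^ m * h) $ m \<noteq> 0"
    and "subdegree ((cexp \<xi> G ^ m * h) $ m) = subdegree (h $ 0)"
proof -
  have eq: "(cexp \<xi> G ^ m * h) $ m = (cofactor $ 0) ^ m * h $ 0"
    by (simp add: nth_cexp_G_power_mult fps_power_zeroth)
  have "cofactor $ 0 \<noteq> 0" using cofactor_00 by auto
  moreover have "subdegree (cofactor $ 0) = 0" using cofactor_00 by (simp add: subdegree_eq_0)
  ultimately show "(cexp \<xi> G ^ m * h) $ m \<noteq> 0"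
    "subdegree ((cexp \<xi> G ^ m * h) $ m) = subdegree (h $ 0)"
    using assms by (simp_all add: eq)
qed

text \<open>\<open>h\<close> expands the factor left after dividing out \<open>G ^ m\<close>. The
  Bezout bound n <= d (k - m d) is rearranged into a linear condition on the exponent (n,
  m).\<close>

lemma lexicographically_leading_term:
  assumes "homogeneous_deg F k" "F \<noteq> 0"
  obtains m h where "cexp \<xi> F = cexp \<xi> G ^ m * h" "h $ 0 \<noteq> 0"
    "subdegree (h $ 0) + d\<^sup>2 * m \<le> d * k"
proof -
  obtain m H where H: "F = G ^ m * H" "m * d \<le> k" "rho H \<noteq> 0"
      "subdegree (rho H) \<le> d * (k - m * d)"
    using factor_out_curve[OF assms] by blast
  have "d * (k - m * d) + d\<^sup>2 * m = d * k"
    using H(2) by (simp add: power2_eq_square mult.assoc mult.commute[of m d] flip: distrib_left)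
  with H(4) have "subdegree (rho H) + d\<^sup>2 * m \<le> d * k" by linarith
  then show ?thesis
    using that[of m "cexp \<xi> H"] H by (simp add: cexp.mult cexp.power restrict_to_branch_def)
qed

text \<open>The flag valuation reads off the exponent of the lexicographically leading term, the
  power of w first; hence the swapped order of \<open>i\<close> and \<open>j\<close>.\<close>

lemma flag_val_in_support:
  assumes "homogeneous_deg F k" "F \<noteq> 0"
  shows "\<exists>i j. flag_val \<xi> G F = (real j, real i) \<and> acoef \<xi> F i j \<noteq> 0 \<and> i + d\<^sup>2 * j \<le> d * k"
proof -
  obtain m h where F: "cexp \<xi> F = cexp \<xi> G ^ m * h" "h $ 0 \<noteq> 0"
    "subdegree (h $ 0) + d\<^sup>2 * m \<le> d * k"
    using lexicographically_leading_term[OF assms] by blast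
  note lead = subdegree_nth_cexp_G_power_mult[OF F(2), of m, folded F(1)]
  have ord: "ord_C \<xi> G F = m"
    unfolding ord_C_def
  proof (rule Greatest_equality)
    fix y assume "cexp \<xi> G ^ y dvd cexp \<xi> F"
    then obtain q where "cexp \<xi> F = cexp \<xi> G ^ y * q" by auto
    \<comment> \<open>Divisibility by a higher power would kill the coefficient of w^m.\<close>
    with lead(1) show "y \<le> m" by (metis nth_cexp_G_power_mult not_le)
  qed (simp add: F(1))
  define h' where "h' = (SOME h. cexp \<xi> F = cexp \<xi> G ^ m * h)"
  have "cexp \<xi> F = cexp \<xi> G ^ m * h'"
    unfolding h'_def by (rule someI[of _ h]) (rule F(1))
  \<comment> \<open>Power series form a domain, so the quotient chosen by \<open>SOME\<close> is
    \<open>h\<close>.\<close>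
  moreover have "cexp \<xi> G \<noteq> 0"
    using cofactor_00 by (auto simp: cexp_G)
  ultimately have "h' = h" using F(1) by simp
  then have "flag_val \<xi> G F = (real m, real (subdegree (h $ 0)))"
    by (simp add: flag_val_def ord Let_def flip: h'_def)
  moreover have "acoef \<xi> F (subdegree (h $ 0)) m \<noteq> 0"
    using lead by (metis acoef_def nth_subdegree_nonzero)
  ultimately show ?thesis using F(3) by blast
qed

text \<open>The exponent (i, j) realising v_+ has j >= m, as w^m divides the expansion, and i + s j
  <= n + s m by minimality. Subtracting (s - d^2) j >= (s - d^2) m gives i + d^2 j <= n + d^2
  m.\<close>

lemma vplus_in_support:
  assumes "homogeneous_deg F k" "F \<noteq> 0" and s: "s \<ge> (real d)\<^sup>2"
  shows "\<exists>i j. vplus \<xi> s F = (real i + s * real j, real j) \<and> acoef \<xi> F i j \<noteq> 0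
    \<and> i + d\<^sup>2 * j \<le> d * k"
proof -
  obtain m h where F: "cexp \<xi> F = cexp \<xi> G ^ m * h" "h $ 0 \<noteq> 0"
    "subdegree (h $ 0) + d\<^sup>2 * m \<le> d * k"
    using lexicographically_leading_term[OF assms(1,2)] by blast
  define n where "n = subdegree (h $ 0)"
  note lead = subdegree_nth_cexp_G_power_mult[OF F(2), of m, folded F(1)]
  have nm: "acoef \<xi> F n m \<noteq> 0"
    using lead unfolding n_def by (metis acoef_def nth_subdegree_nonzero)
  have m_le: "m \<le> j" if "acoef \<xi> F i j \<noteq> 0" for i j
    using that by (auto simp: acoef_def F(1) nth_cexp_G_power_mult split: if_splits)
  have "s > 0" using s d_pos by (smt (verit) of_nat_1 of_nat_le_iff one_le_power)
  define \<phi> where "\<phi> p = real (fst p) + s * real (snd p)" for p :: "nat \<times> nat"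
  \<comment> \<open>Only finitely many exponents weigh no more than (n, m), because s > 0; so the
    infimum \<open>v1\<close> is attained.\<close>
  define A where "A = {p. acoef \<xi> F (fst p) (snd p) \<noteq> 0 \<and> \<phi> p \<le> \<phi> (n, m)}"
  have "A \<subseteq> {..nat \<lceil>\<phi> (n, m)\<rceil>} \<times> {..nat \<lceil>\<phi> (n, m) / s\<rceil>}"
  proof
    fix p assume "p \<in> A"
    then have le: "real (fst p) + s * real (snd p) \<le> \<phi> (n, m)" by (simp add: A_def \<phi>_def[of p])
    moreover have "0 \<le> s * real (snd p)" using \<open>s > 0\<close> by simp
    ultimately have "real (fst p) \<le> \<phi> (n, m)" by linarith
    moreover have "real (snd p) \<le> \<phi> (n, m) / s"
      using le \<open>s > 0\<close> by (simp add: pos_le_divide_eq mult.commute)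
    ultimately show "p \<in> {..nat \<lceil>\<phi> (n, m)\<rceil>} \<times> {..nat \<lceil>\<phi> (n, m) / s\<rceil>}"
      by (cases p) (auto simp: le_nat_iff, linarith+)
  qed
  then have "finite A" by (rule finite_subset) auto
  moreover have "(n, m) \<in> A" using nm by (simp add: A_def)
  ultimately obtain p where p: "p \<in> A" "\<And>x. x \<in> A \<Longrightarrow> \<phi> p \<le> \<phi> x"
    by (metis arg_min_if_finite(1) arg_min_least empty_iff)
  have p_min: "\<phi> p \<le> real i + s * real j" if "acoef \<xi> F i j \<noteq> 0" for i j
    using that p(1) p(2)[of "(i, j)"] by (cases "(i, j) \<in> A") (auto simp: A_def \<phi>_def)
  have v1: "v1 \<xi> s F = \<phi> p"
    unfolding v1_def
  proof (rule cInf_eq_minimum)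
    show "\<phi> p \<in> {real i + s * real j |i j. acoef \<xi> F i j \<noteq> 0}"
      using p(1) by (auto simp: A_def \<phi>_def)
  qed (use p_min in auto)
  define R where "R j \<longleftrightarrow> (\<exists>i. acoef \<xi> F i j \<noteq> 0 \<and> real i + s * real j = \<phi> p)" for j
  define j where "j = (LEAST j. R j)"
  have "R (snd p)" using p(1) by (auto simp: R_def A_def \<phi>_def)
  then have "R j" unfolding j_def by (rule LeastI)
  have "Inf {real j |j. R j} = real j"
    by (rule cInf_eq_minimum) (use \<open>R j\<close> Least_le[of R] in \<open>auto simp: j_def\<close>)
  then have vp: "vplus \<xi> s F = (\<phi> p, real j)"
    by (simp add: vplus_def v1 R_def)
  obtain i where i: "acoef \<xi> F i j \<noteq> 0" "real i + s * real j = \<phi> p"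
    using \<open>R j\<close> by (auto simp: R_def)
  have "real m \<le> real j" using m_le[OF i(1)] by simp
  then have "(s - (real d)\<^sup>2) * real m \<le> (s - (real d)\<^sup>2) * real j"
    using s by (intro mult_left_mono) auto
  moreover have "real i + s * real j \<le> real n + s * real m"
    using p_min[OF nm] i(2) by simp
  ultimately have "real i + (real d)\<^sup>2 * real j \<le> real n + (real d)\<^sup>2 * real m"
    by (simp add: algebra_simps)
  then have "real (i + d\<^sup>2 * j) \<le> real (n + d\<^sup>2 * m)" by simp
  then have "i + d\<^sup>2 * j \<le> n + d\<^sup>2 * m" by (simp only: of_nat_le_iff)
  with F(3) have "i + d\<^sup>2 * j \<le> d * k" by (simp add: n_def)
  with i vp show ?thesis by (intro exI[of _ i] exI[of _ j]) simp
qed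

text \<open>The triangle \<open>i + d\<^sup>2 j \<le> d k\<close>, with \<open>k = d r\<^sup>2\<close>, has only \<open>O(k)\<close> lattice
  points more than there are monomials of degree \<open>k\<close>.  Hence a nonzero form has its coefficients
  vanish at all of these points outside a corner box of side \<open>d r\<close>.\<close>

lemma form_with_support_near_corner:
  assumes "r \<ge> d + 1"
  shows "\<exists>F. F \<noteq> 0 \<and> homogeneous_deg F (d * r\<^sup>2) \<and>
    (\<forall>i j. acoef \<xi> F i j \<noteq> 0 \<longrightarrow> i + d\<^sup>2 * j \<le> d * (d * r\<^sup>2) \<longrightarrow>
      j < d * r \<and> d * (d * r\<^sup>2) < i + d\<^sup>2 * j + d * r)"
proof -
  define q where "q = r\<^sup>2"
  \<comment> \<open>Pairs list the exponent of w first. Since k = d q, the triangle is i + d^2 j <=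
    d^2 q.\<close>
  define Q where "Q = Sigma {..q} (\<lambda>j. {..d\<^sup>2 * (q - j)})"
  \<comment> \<open>The box has \<open>d * r\<close> rows, each with the last \<open>d * r\<close>
    points up to the hypotenuse: (d r)^2 = d^2 q points.\<close>
  define S where "S = Sigma {..<d * r} (\<lambda>j. {d\<^sup>2 * (q - j) - d * r<..d\<^sup>2 * (q - j)})"
  \<comment> \<open>\<open>r \<ge> d + 1\<close> makes these rows long enough for the box to fit
    into the triangle.\<close>
  have box: "j \<le> q \<and> d * r \<le> d\<^sup>2 * (q - j)" if "j < d * r" for j
  proof -
    have "(d + 1) * r \<le> r * r" using assms by (intro mult_right_mono) auto
    with that have "r \<le> q - j" "j \<le> q" by (auto simp: q_def power2_eq_square algebra_simps)
    moreover have "d * 1 \<le> d * d" using d_pos by (intro mult_le_mono) auto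
    then have "d * r \<le> d\<^sup>2 * r" by (simp add: power2_eq_square)
    ultimately show ?thesis by (meson le_trans mult_le_mono2)
  qed
  have "S \<subseteq> Q" using box by (auto simp: S_def Q_def)
  have "finite Q" by (simp add: Q_def)
  have "card S = (\<Sum>j<d * r. d * r)"
    unfolding S_def by (subst card_SigmaI) (use box in \<open>auto intro!: sum.cong\<close>)
  then have card_S: "card S = d\<^sup>2 * q" by (simp add: q_def power2_eq_square)
  have "card Q = (\<Sum>j\<le>q. Suc (d\<^sup>2 * (q - j)))"
    unfolding Q_def by simp
  also have "\<dots> = (\<Sum>j\<le>q. Suc (d\<^sup>2 * j))"
    using sum.nat_diff_reindex[of "\<lambda>j. Suc (d\<^sup>2 * j)" "Suc q"] by (simp add: lessThan_Suc_atMost)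
  finally have "2 * card Q = 2 * (\<Sum>j\<le>q. Suc (d\<^sup>2 * j))" by simp
  also have "\<dots> = d\<^sup>2 * (q * (q + 1)) + 2 * (q + 1)"
    by (induction q) (auto simp: algebra_simps)
  finally have card_Q: "2 * card Q = d\<^sup>2 * (q * (q + 1)) + 2 * (q + 1)" .
  have "card (Q - S) < card (hexps (d * q))"
  proof -
    have "q \<ge> 1" using assms by (simp add: q_def)
    have "card (Q - S) = card Q - card S"
      using \<open>S \<subseteq> Q\<close> \<open>finite Q\<close> by (meson card_Diff_subset finite_subset)
    moreover have "card S \<le> card Q" using \<open>S \<subseteq> Q\<close> \<open>finite Q\<close> by (rule card_mono[rotated])
    ultimately have "2 * card (Q - S) + 2 * (d\<^sup>2 * q) = d\<^sup>2 * (q * (q + 1)) + 2 * (q + 1)"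
      using card_Q card_S by simp
    \<comment> \<open>After cancellation this is 2 q < d^2 q + 3 d q: a box of d^2 q points absorbs
      the surplus of the triangle over the monomials.\<close>
    also have "\<dots> < (d * q + 1) * (d * q + 2) + 2 * (d\<^sup>2 * q)"
    proof -
      have "q * 3 \<le> d * (q * 3)" using d_pos by simp
      then have "q * 2 < d * (d * q) + d * (q * 3)" using \<open>q \<ge> 1\<close> by linarith
      then show ?thesis by (simp add: algebra_simps power2_eq_square)
    qed
    finally show ?thesis using card_hexps[of "d * q"] by linarith
  qed
  then obtain c where c: "\<exists>p\<in>hexps (d * q). c p \<noteq> 0"
    "\<forall>x\<in>Q - S. (\<Sum>p\<in>hexps (d * q). c p *
        acoef \<xi> (hmonom 1 (fst p) (snd p) (d * q - fst p - snd p)) (snd x) (fst x)) = 0"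
    using homogeneous_system_nontrivial_solution[of "Q - S" "hexps (d * q)"
        "\<lambda>p x. acoef \<xi> (hmonom 1 (fst p) (snd p) (d * q - fst p - snd p)) (snd x) (fst x)"]
      \<open>finite Q\<close> by auto
  define F where "F = hform (d * q) (hexps (d * q)) c"
  have "F \<noteq> 0" using c(1) hform_eq_0D[of "d * q" "hexps (d * q)" c] by (auto simp: F_def)
  moreover have "homogeneous_deg F (d * q)" by (simp add: F_def homogeneous_deg_hform)
  moreover have "j < d * r \<and> d * (d * q) < i + d\<^sup>2 * j + d * r"
    if nz: "acoef \<xi> F i j \<noteq> 0" and le: "i + d\<^sup>2 * j \<le> d * (d * q)" for i j
  proof -
    have dq: "d * (d * q) = d\<^sup>2 * q" by (simp add: power2_eq_square)
    have "d\<^sup>2 * j \<le> d\<^sup>2 * q" using le dq by linarith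
    then have "j \<le> q" using d_pos by simp
    then have diff: "d\<^sup>2 * (q - j) + d\<^sup>2 * j = d\<^sup>2 * q" by (simp flip: distrib_left)
    have "acoef \<xi> F i j = (\<Sum>p\<in>hexps (d * q). c p *
        acoef \<xi> (hmonom 1 (fst p) (snd p) (d * q - fst p - snd p)) i j)"
      unfolding F_def hform_def acoef_sum by (intro sum.cong refl acoef_hmonom)
    with nz c(2) have "(j, i) \<notin> Q - S" by force
    moreover have "(j, i) \<in> Q" using \<open>j \<le> q\<close> le dq diff by (auto simp: Q_def)
    ultimately have "j < d * r" "d\<^sup>2 * (q - j) - d * r < i" by (auto simp: S_def)
    with dq diff show ?thesis by linarith
  qed
  ultimately show ?thesis unfolding q_def by blast
qed

subsection \<open>The convex bodies\<close>

text \<open>One argument serves both bodies. It uses only that each value is \<open>L\<close> of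
  some exponent of the expansion within the triangle; forms with few such exponents then pin down
  the vertices.\<close>

lemma closure_convex_hull_normalized_values:
  fixes L :: "real \<times> real \<Rightarrow> real \<times> real" and w :: "complex poly poly poly \<Rightarrow> real \<times> real"
  assumes "linear L"
    and w: "\<And>k F. \<lbrakk>F \<noteq> 0; homogeneous_deg F k\<rbrakk> \<Longrightarrow>
      \<exists>i j. w F = L (real i, real j) \<and> acoef \<xi> F i j \<noteq> 0 \<and> i + d\<^sup>2 * j \<le> d * k"
  shows "closure (convex hull
      {(1 / real k) *\<^sub>R w F | k F. k \<ge> 1 \<and> F \<noteq> 0 \<and> homogeneous_deg F k})
    = convex hull (L ` {(0, 0), (real d, 0), (0, 1 / real d)})" (is "closure (convex hull ?X) = ?T")
proof
  interpret L: linear L by fact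
  have T: "?T = L ` (convex hull {(0, 0), (real d, 0), (0, 1 / real d)})"
    by (simp only: convex_hull_linear_image[OF \<open>linear L\<close>])
  have d: "real d > 0" using d_pos by simp
  show "closure (convex hull ?X) \<subseteq> ?T"
  proof (rule closure_minimal)
    show "closed ?T"
      by (intro compact_imp_closed finite_imp_compact_convex_hull) simp
    show "convex hull ?X \<subseteq> ?T"
    proof (rule hull_minimal)
      show "?X \<subseteq> ?T"
      proof
        fix z assume "z \<in> ?X"
        then obtain k F where z: "z = (1 / real k) *\<^sub>R w F" "k \<ge> 1" "F \<noteq> 0" "homogeneous_deg F k"
          by blast
        then obtain i j where ij: "w F = L (real i, real j)" "i + d\<^sup>2 * j \<le> d * k"
          using w by blast
        define x where "x = real i / real k"
        define y where "y = real j / real k"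
        have "real (i + d\<^sup>2 * j) \<le> real (d * k)" using ij(2) by (simp only: of_nat_le_iff)
        then have "x + (real d)\<^sup>2 * y \<le> real d"
          using z(2) by (simp add: x_def y_def divide_simps)
        then have "x / real d + real d * y \<le> 1"
          using d by (simp add: field_simps power2_eq_square)
        moreover have "0 \<le> x" "0 \<le> y" by (simp_all add: x_def y_def)
        ultimately have "(x, y) \<in> convex hull {(0, 0), (real d, 0), (0, 1 / real d)}"
          \<comment> \<open>The weights are the barycentric coordinates of (x, y).\<close>
          unfolding convex_hull_3
          by (intro CollectI exI[of _ "1 - x / real d - real d * y"] exI[of _ "x / real d"]
              exI[of _ "real d * y"]) (use d in auto)
        moreover have "z = L (x, y)"
          using z(1) ij(1) by (simp add: x_def y_def flip: L.scaleR)
        ultimately show "z \<in> ?T" unfolding T by blast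
      qed
    qed simp
  qed
  have mem: "(1 / real k) *\<^sub>R w F \<in> closure (convex hull ?X)"
    if "k \<ge> 1" "F \<noteq> 0" "homogeneous_deg F k" for k F
    using that by (intro subsetD[OF closure_subset] hull_inc) blast
  show "?T \<subseteq> closure (convex hull ?X)"
  proof (rule hull_minimal)
    have "L (0, 0) \<in> closure (convex hull ?X)"
    proof -
      define Z where "Z = hmonom 1 0 0 1"
      have Z: "Z \<noteq> 0" "homogeneous_deg Z 1"
        using homogeneous_deg_hmonom[of 1 0 0 1] by (simp_all add: Z_def hmonom_def monom_eq_0_iff)
      then obtain i j where ij: "w Z = L (real i, real j)" "acoef \<xi> Z i j \<noteq> 0"
        using w by blast
      \<comment> \<open>Z dehomogenises to 1, whose only exponent is (0, 0).\<close>
      have "i = 0 \<and> j = 0"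
        using ij(2) by (auto simp: Z_def acoef_def cexp_hmonom split: if_splits)
      with ij mem[OF _ Z] show ?thesis by simp
    qed
    moreover have "L (0, 1 / real d) \<in> closure (convex hull ?X)"
    proof -
      obtain i j where ij: "w G = L (real i, real j)" "acoef \<xi> G i j \<noteq> 0" "i + d\<^sup>2 * j \<le> d * d"
        using w[OF G_nonzero hom_G] by blast
      \<comment> \<open>w divides the expansion of \<open>G\<close>, so j >= 1, while the triangle
        of degree \<open>d\<close> allows only j <= 1; no room is left for i.\<close>
      have "j \<noteq> 0" using ij(2) branch_on_curve by (cases j) (auto simp: acoef_def)
      moreover have "d\<^sup>2 * j \<le> d\<^sup>2 * 1" using ij(3) unfolding power2_eq_square by linarith
      ultimately have "j = 1" using d_pos by simp
      with ij(3) have "i = 0" by (simp add: power2_eq_square)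
      have "(1 / real d) *\<^sub>R w G = L (0, 1 / real d)"
        using ij(1) \<open>i = 0\<close> \<open>j = 1\<close> by (simp flip: L.scaleR)
      with mem[OF d_pos G_nonzero hom_G] show ?thesis by simp
    qed
    moreover have "L (real d, 0) \<in> closure (convex hull ?X)"
    proof -
      \<comment> \<open>Divided by k = d r^2, the box of side d r shrinks to size O(1/r) around (d,
        0), whichever exponent in it the valuation selects.\<close>
      define good where "good r i j \<longleftrightarrow>
          L (real i / real (d * r\<^sup>2), real j / real (d * r\<^sup>2)) \<in> closure (convex hull ?X) \<and>
          i + d\<^sup>2 * j \<le> d * (d * r\<^sup>2) \<and> j < d * r \<and> d * (d * r\<^sup>2) < i + d\<^sup>2 * j + d * r"
        for r i j
      have "\<exists>i j. good r i j" if r: "r \<ge> d + 1" for r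
      proof -
        obtain F where F: "F \<noteq> 0" "homogeneous_deg F (d * r\<^sup>2)"
          "\<And>i j. \<lbrakk>acoef \<xi> F i j \<noteq> 0; i + d\<^sup>2 * j \<le> d * (d * r\<^sup>2)\<rbrakk> \<Longrightarrow>
            j < d * r \<and> d * (d * r\<^sup>2) < i + d\<^sup>2 * j + d * r"
          using form_with_support_near_corner[OF r] by blast
        obtain i j where ij: "w F = L (real i, real j)" "acoef \<xi> F i j \<noteq> 0"
            "i + d\<^sup>2 * j \<le> d * (d * r\<^sup>2)"
          using w[OF F(1,2)] by blast
        have "d * r\<^sup>2 \<ge> 1" using d_pos r by simp
        then have "(1 / real (d * r\<^sup>2)) *\<^sub>R w F \<in> closure (convex hull ?X)"
          using F by (intro mem)
        then have "L (real i / real (d * r\<^sup>2), real j / real (d * r\<^sup>2)) \<in> closure (convex hull ?X)"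
          unfolding ij(1) L.scaleR[symmetric] by simp
        with ij F(3) show ?thesis unfolding good_def by blast
      qed
      then obtain I J where "\<And>r. r \<ge> d + 1 \<Longrightarrow> good r (I r) (J r)"
        by metis
      note IJ = this[unfolded good_def]
      define x where "x r = real (I r) / real (d * r\<^sup>2)" for r
      define y where "y r = real (J r) / real (d * r\<^sup>2)" for r
      have y_le: "y r \<le> 1 / real r" if "r \<ge> d + 1" for r
      proof -
        have "real (J r) \<le> real (d * r)" using IJ[OF that] by (subst of_nat_le_iff) linarith
        then have "y r \<le> real (d * r) / real (d * r\<^sup>2)"
          unfolding y_def by (intro divide_right_mono) auto
        also have "\<dots> = 1 / real r" using d that by (simp add: power2_eq_square)
        finally show ?thesis .
      qed
      have x_le: "x r \<le> real d" if "r \<ge> d + 1" for r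
      proof -
        have "real (I r) \<le> real (d * (d * r\<^sup>2))"
          using IJ[OF that] by (subst of_nat_le_iff) linarith
        then show ?thesis using d that by (simp add: x_def divide_simps mult_ac)
      qed
      have x_ge: "real d - ((real d)\<^sup>2 + 1) / real r \<le> x r" if "r \<ge> d + 1" for r
      proof -
        have pos: "real r > 0" using that by simp
        have "real (d * (d * r\<^sup>2)) \<le> real (I r + d\<^sup>2 * J r + d * r)"
          using IJ[OF that] by (subst of_nat_le_iff) linarith
        then have "real (d * (d * r\<^sup>2)) / real (d * r\<^sup>2)
            \<le> real (I r + d\<^sup>2 * J r + d * r) / real (d * r\<^sup>2)"
          by (rule divide_right_mono) simp
        then have "real d \<le> x r + (real d)\<^sup>2 * y r + real (d * r) / real (d * r\<^sup>2)"
          using d pos by (simp add: x_def y_def add_divide_distrib)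
        also have "real (d * r) / real (d * r\<^sup>2) = 1 / real r"
          using d that by (simp add: power2_eq_square)
        also have "(real d)\<^sup>2 * y r \<le> (real d)\<^sup>2 * (1 / real r)"
          by (rule mult_left_mono[OF y_le[OF that]]) simp
        finally show ?thesis by (simp add: add_divide_distrib algebra_simps)
      qed
      have "x \<longlonglongrightarrow> real d"
      proof (rule tendsto_sandwich)
        show "\<forall>\<^sub>F r in sequentially. real d - ((real d)\<^sup>2 + 1) / real r \<le> x r"
          using eventually_ge_at_top[of "d + 1"] by eventually_elim (rule x_ge)
        show "\<forall>\<^sub>F r in sequentially. x r \<le> real d"
          using eventually_ge_at_top[of "d + 1"] by eventually_elim (rule x_le)
        show "(\<lambda>r. real d - ((real d)\<^sup>2 + 1) / real r) \<longlonglongrightarrow> real d"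
          using tendsto_diff[OF tendsto_const lim_const_over_n, of "real d" "(real d)\<^sup>2 + 1"] by simp
      qed simp
      moreover have "y \<longlonglongrightarrow> 0"
      proof (rule tendsto_sandwich[OF _ _ tendsto_const])
        show "\<forall>\<^sub>F r in sequentially. y r \<le> 1 / real r"
          using eventually_ge_at_top[of "d + 1"] by eventually_elim (rule y_le)
        show "(\<lambda>r. 1 / real r) \<longlonglongrightarrow> 0" by (rule lim_const_over_n)
      qed (simp_all add: y_def)
      ultimately have "(\<lambda>r. (x r, y r)) \<longlonglongrightarrow> (real d, 0)" by (rule tendsto_Pair)
      then have "(\<lambda>r. L (x r, y r)) \<longlonglongrightarrow> L (real d, 0)"
        using \<open>linear L\<close> by (metis linear_conv_bounded_linear bounded_linear.tendsto)
      moreover have "\<forall>\<^sub>F r in sequentially. L (x r, y r) \<in> closure (convex hull ?X)"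
        using eventually_ge_at_top[of "d + 1"] by eventually_elim (use IJ in \<open>simp add: x_def y_def\<close>)
      ultimately show ?thesis by (rule Lim_in_closed_set[OF closed_closure, rotated 2]) simp
    qed
    ultimately show "L ` {(0, 0), (real d, 0), (0, 1 / real d)} \<subseteq> closure (convex hull ?X)" by simp
  qed (intro convex_closure convex_convex_hull)
qed

end

theorem theorem5p11:
  fixes G :: "complex poly poly poly" and d :: nat and \<xi> :: "complex fps" and s :: real
  assumes "homogeneous_deg G d" and "irreducible G"
    and "hcoeff G 0 0 d = 0"
    and "hcoeff G 0 1 (d - 1) \<noteq> 0"
    and "hcoeff G 1 0 (d - 1) = 0"
    and "fps_nth \<xi> 0 = 0" and "fps_nth \<xi> 1 = 0"
    and "fps_nth (cexp \<xi> G) 0 = 0"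
    and "s \<in> \<rat>" and "s \<ge> real d ^ 2"
  shows "Delta_s_plus \<xi> s = tri (real d) (s / real d) (1 / real d)
    \<and> NO_body \<xi> G = tri (1 / real d) 0 (real d)
    \<and> NO_body \<xi> G = (\<lambda>(t, u). (u, t - s * u)) ` Delta_s_plus \<xi> s"
proof -
  interpret plane_branch G d \<xi>
    using assms by unfold_locales auto
  let ?A = "\<lambda>(t, u). (u, t - s * u)"
  have linear_A: "linear ?A"
    by (rule linearI) (auto simp: algebra_simps)
  \<comment> \<open>v_+ is a shear of the exponent: it fixes (d, 0) and takes (0, 1/d) to (s/d,
    1/d).\<close>
  have "linear (\<lambda>(x, y). (x + s * y, y))"
    by (rule linearI) (auto simp: algebra_simps)
  from closure_convex_hull_normalized_values[OF this, of "vplus \<xi> s"]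
  have Delta: "Delta_s_plus \<xi> s = tri (real d) (s / real d) (1 / real d)"
    using vplus_in_support assms(10) by (simp add: Delta_s_plus_def tri_def)
  have "linear (\<lambda>(x :: real, y :: real). (y, x))"
    by (rule linearI) auto
  from closure_convex_hull_normalized_values[OF this, of "flag_val \<xi> G"]
  have NO: "NO_body \<xi> G = tri (1 / real d) 0 (real d)"
    using flag_val_in_support by (simp add: NO_body_def tri_def insert_commute)
  \<comment> \<open>The matrix undoes the shear and swaps the axes: (s/d, 1/d) goes to (1/d, 0) and
    (d, 0) to (0, d).\<close>
  have "?A ` tri (real d) (s / real d) (1 / real d) = tri (1 / real d) 0 (real d)"
    unfolding tri_def convex_hull_linear_image[OF linear_A] by (simp add: insert_commute)
  with Delta NO show ?thesis by simp
qed

end
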